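(* Let $S$ and $T$ be 2-monads on a 2-category $\mathcal C$, and let $\lambda\colon ST\Rightarrow TS$ be a 2-categorical distributive law. Let $f,g\colon A\to B$ be (underlying 1-cells of) weak maps of $TS$-algebras. Then a transformation $\alpha\colon f\Rightarrow g$ of $TS$-algebras is precisely a 2-cell $\alpha\colon f\Rightarrow g$ of $\mathcal C$ that is both a transformation of $S$-algebras and a transformation of $T$-algebras between the associated weak maps (with no further axiom).
   Context: $\mathcal C$ is a strict 2-category, $S,T$ are strict 2-monads, and a 2-categorical distributive law is a 2-natural transformation $\lambda\colon ST\Rightarrow TS$ satisfying Beck's four distributive law axioms on the nose, so that $TS$ is a 2-monad. Algebras are strict. For a 2-monad $R$ and strict $R$-algebras $a\colon RA\to A$, $b\colon RB\to B$, a weak map is a 1-cell $f\colon A\to B$ with an invertible 2-cell $\rho_f\colon b\circ Rf\Rightarrow f\circ a$ such that $(\rho_f*Ra)\circ(b*R\rho_f)=\rho_f*\mu_A$ and $\rho_f*\eta_A=1_f$. A transformation (of $R$-algebras) between weak maps $(f,\rho_f),(g,\rho_g)$ is a 2-cell $\alpha\colon f\Rightarrow g$ such that $\rho_g\circ(b*R\alpha)=(\alpha*a)\circ\rho_f$. A $TS$-algebra $\theta\colon TSA\to A$ has an associated $S$-algebra $\theta\circ\eta^T_{SA}\colon SA\to A$ and an associated $T$-algebra $\theta\circ T\eta^S_A\colon TA\to A$. A weak map $(f,\zeta_f)$ of $TS$-algebras has an associated weak map of $S$-algebras $(f,\ \zeta_f*\eta^T_{SA})$ and an associated weak map of $T$-algebras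 $(f,\ \zeta_f*T\eta^S_A)$. *)

theory Defs
  imports Main
begin

section \<open>Strict 2-categories\<close>

text \<open>
  A strict 2-category has carrier sets of objects, 1-cells and 2-cells.  Compositions are total
  functions, constrained only on composable arguments, and are written in
  applicative order: \<open>g \<odot> f\<close> is ``g after f'', \<open>\<beta> \<cdot> \<alpha>\<close> is vertical and \<open>\<beta> \<star> \<alpha>\<close> horizontal
  composition of 2-cells.
\<close>

record ('o, 'm, 'c) two_cat =
  obj :: "'o set"
  arr :: "'m set"
  src :: "'m \<Rightarrow> 'o"
  trg :: "'m \<Rightarrow> 'o"
  id1 :: "'o \<Rightarrow> 'm"
  comp1 :: "'m \<Rightarrow> 'm \<Rightarrow> 'm" (infixr "\<odot>\<index>" 75)
  cell :: "'c set"
  dom2 :: "'c \<Rightarrow> 'm"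
  cod2 :: "'c \<Rightarrow> 'm"
  id2 :: "'m \<Rightarrow> 'c"
  vcomp :: "'c \<Rightarrow> 'c \<Rightarrow> 'c" (infixr "\<cdot>\<index>" 60)
  hcomp :: "'c \<Rightarrow> 'c \<Rightarrow> 'c" (infixr "\<star>\<index>" 65)

definition hom1 :: "('o, 'm, 'c, 'z) two_cat_scheme \<Rightarrow> 'o \<Rightarrow> 'o \<Rightarrow> 'm set" where
  "hom1 C A B = {f \<in> arr C. src C f = A \<and> trg C f = B}"

definition hom2 :: "('o, 'm, 'c, 'z) two_cat_scheme \<Rightarrow> 'm \<Rightarrow> 'm \<Rightarrow> 'c set" where
  "hom2 C f g = {\<alpha> \<in> cell C. dom2 C \<alpha> = f \<and> cod2 C \<alpha> = g}"

locale strict_2_category =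
  fixes C :: "('o, 'm, 'c) two_cat" (structure)
  assumes src_obj: "f \<in> arr C \<Longrightarrow> src C f \<in> obj C"
    and trg_obj: "f \<in> arr C \<Longrightarrow> trg C f \<in> obj C"
    and id1_hom: "A \<in> obj C \<Longrightarrow> id1 C A \<in> hom1 C A A"
    and comp1_hom: "\<lbrakk>f \<in> hom1 C X Y; g \<in> hom1 C Y Z\<rbrakk> \<Longrightarrow> g \<odot> f \<in> hom1 C X Z"
    and comp1_id_left: "f \<in> hom1 C X Y \<Longrightarrow> id1 C Y \<odot> f = f"
    and comp1_id_right: "f \<in> hom1 C X Y \<Longrightarrow> f \<odot> id1 C X = f"
    and comp1_assoc: "\<lbrakk>f \<in> hom1 C W X; g \<in> hom1 C X Y; h \<in> hom1 C Y Z\<rbrakk>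
      \<Longrightarrow> (h \<odot> g) \<odot> f = h \<odot> (g \<odot> f)"
    and dom_arr: "\<alpha> \<in> cell C \<Longrightarrow> dom2 C \<alpha> \<in> arr C"
    and cod_arr: "\<alpha> \<in> cell C \<Longrightarrow> cod2 C \<alpha> \<in> arr C"
    and src_parallel: "\<alpha> \<in> cell C \<Longrightarrow> src C (dom2 C \<alpha>) = src C (cod2 C \<alpha>)"
    and trg_parallel: "\<alpha> \<in> cell C \<Longrightarrow> trg C (dom2 C \<alpha>) = trg C (cod2 C \<alpha>)"
    and id2_hom: "f \<in> arr C \<Longrightarrow> id2 C f \<in> hom2 C f f"
    and vcomp_hom: "\<lbrakk>\<alpha> \<in> hom2 C f g; \<beta> \<in> hom2 C g h\<rbrakk> \<Longrightarrow> \<beta> \<cdot> \<alpha> \<in> hom2 C f h"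
    and vcomp_id_left: "\<alpha> \<in> hom2 C f g \<Longrightarrow> id2 C g \<cdot> \<alpha> = \<alpha>"
    and vcomp_id_right: "\<alpha> \<in> hom2 C f g \<Longrightarrow> \<alpha> \<cdot> id2 C f = \<alpha>"
    and vcomp_assoc: "\<lbrakk>\<alpha> \<in> hom2 C f g; \<beta> \<in> hom2 C g h; \<gamma> \<in> hom2 C h k\<rbrakk>
      \<Longrightarrow> (\<gamma> \<cdot> \<beta>) \<cdot> \<alpha> = \<gamma> \<cdot> (\<beta> \<cdot> \<alpha>)"
    and hcomp_hom: "\<lbrakk>f \<in> hom1 C X Y; \<alpha> \<in> hom2 C f f'; g \<in> hom1 C Y Z; \<beta> \<in> hom2 C g g'\<rbrakk>
      \<Longrightarrow> \<beta> \<star> \<alpha> \<in> hom2 C (g \<odot> f) (g' \<odot> f')"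
    and hcomp_id_left: "\<lbrakk>f \<in> hom1 C X Y; \<alpha> \<in> hom2 C f f'\<rbrakk> \<Longrightarrow> id2 C (id1 C Y) \<star> \<alpha> = \<alpha>"
    and hcomp_id_right: "\<lbrakk>f \<in> hom1 C X Y; \<alpha> \<in> hom2 C f f'\<rbrakk> \<Longrightarrow> \<alpha> \<star> id2 C (id1 C X) = \<alpha>"
    and hcomp_assoc: "\<lbrakk>f \<in> hom1 C W X; \<alpha> \<in> hom2 C f f'; g \<in> hom1 C X Y; \<beta> \<in> hom2 C g g';
      h \<in> hom1 C Y Z; \<gamma> \<in> hom2 C h h'\<rbrakk> \<Longrightarrow> (\<gamma> \<star> \<beta>) \<star> \<alpha> = \<gamma> \<star> (\<beta> \<star> \<alpha>)"
    and hcomp_id2: "\<lbrakk>f \<in> hom1 C X Y; g \<in> hom1 C Y Z\<rbrakk>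
      \<Longrightarrow> id2 C g \<star> id2 C f = id2 C (g \<odot> f)"
    and interchange: "\<lbrakk>f \<in> hom1 C X Y; \<alpha> \<in> hom2 C f f'; \<alpha>' \<in> hom2 C f' f'';
      g \<in> hom1 C Y Z; \<beta> \<in> hom2 C g g'; \<beta>' \<in> hom2 C g' g''\<rbrakk>
      \<Longrightarrow> (\<beta>' \<cdot> \<beta>) \<star> (\<alpha>' \<cdot> \<alpha>) = (\<beta>' \<star> \<alpha>') \<cdot> (\<beta> \<star> \<alpha>)"

definition whisker_left :: "('o, 'm, 'c) two_cat \<Rightarrow> 'm \<Rightarrow> 'c \<Rightarrow> 'c" (infixr "\<rhd>\<index>" 70) where
  "whisker_left C h \<alpha> = id2 C h \<star>\<^bsub>C\<^esub> \<alpha>"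

definition whisker_right :: "('o, 'm, 'c) two_cat \<Rightarrow> 'c \<Rightarrow> 'm \<Rightarrow> 'c" (infixl "\<lhd>\<index>" 70) where
  "whisker_right C \<alpha> h = \<alpha> \<star>\<^bsub>C\<^esub> id2 C h"

definition invertible_2cell :: "('o, 'm, 'c) two_cat \<Rightarrow> 'm \<Rightarrow> 'm \<Rightarrow> 'c \<Rightarrow> bool" where
  "invertible_2cell C f g \<alpha> \<longleftrightarrow> \<alpha> \<in> hom2 C f g \<and>
    (\<exists>\<beta> \<in> hom2 C g f. \<beta> \<cdot>\<^bsub>C\<^esub> \<alpha> = id2 C f \<and> \<alpha> \<cdot>\<^bsub>C\<^esub> \<beta> = id2 C g)"


section \<open>2-functors, 2-natural transformations and 2-monads\<close>

record ('o, 'm, 'c) endo =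
  on0 :: "'o \<Rightarrow> 'o"
  on1 :: "'m \<Rightarrow> 'm"
  on2 :: "'c \<Rightarrow> 'c"

definition id_endo :: "('o, 'm, 'c) endo" where
  "id_endo = \<lparr>on0 = \<lambda>A. A, on1 = \<lambda>f. f, on2 = \<lambda>\<alpha>. \<alpha>\<rparr>"

definition comp_endo ::
  "('o, 'm, 'c, 'x) endo_scheme \<Rightarrow> ('o, 'm, 'c, 'y) endo_scheme \<Rightarrow> ('o, 'm, 'c) endo" where
  "comp_endo F G = \<lparr>on0 = \<lambda>A. on0 F (on0 G A), on1 = \<lambda>f. on1 F (on1 G f), on2 = \<lambda>\<alpha>. on2 F (on2 G \<alpha>)\<rparr>"

locale endo_2_functor = strict_2_category C
  for C :: "('o, 'm, 'c) two_cat" (structure) +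
  fixes F :: "('o, 'm, 'c, 'x) endo_scheme"
  assumes on0_obj: "A \<in> obj C \<Longrightarrow> on0 F A \<in> obj C"
    and on1_hom: "f \<in> hom1 C A B \<Longrightarrow> on1 F f \<in> hom1 C (on0 F A) (on0 F B)"
    and on1_id: "A \<in> obj C \<Longrightarrow> on1 F (id1 C A) = id1 C (on0 F A)"
    and on1_comp: "\<lbrakk>f \<in> hom1 C X Y; g \<in> hom1 C Y Z\<rbrakk> \<Longrightarrow> on1 F (g \<odot> f) = on1 F g \<odot> on1 F f"
    and on2_hom: "\<alpha> \<in> hom2 C f g \<Longrightarrow> on2 F \<alpha> \<in> hom2 C (on1 F f) (on1 F g)"
    and on2_id: "f \<in> arr C \<Longrightarrow> on2 F (id2 C f) = id2 C (on1 F f)"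
    and on2_vcomp: "\<lbrakk>\<alpha> \<in> hom2 C f g; \<beta> \<in> hom2 C g h\<rbrakk> \<Longrightarrow> on2 F (\<beta> \<cdot> \<alpha>) = on2 F \<beta> \<cdot> on2 F \<alpha>"
    and on2_hcomp: "\<lbrakk>f \<in> hom1 C X Y; \<alpha> \<in> hom2 C f f'; g \<in> hom1 C Y Z; \<beta> \<in> hom2 C g g'\<rbrakk>
      \<Longrightarrow> on2 F (\<beta> \<star> \<alpha>) = on2 F \<beta> \<star> on2 F \<alpha>"

locale two_nat_trans =
  F: endo_2_functor C F + G: endo_2_functor C G
  for C :: "('o, 'm, 'c) two_cat" (structure)
    and F :: "('o, 'm, 'c, 'x) endo_scheme"
    and G :: "('o, 'm, 'c, 'y) endo_scheme" +
  fixes \<phi> :: "'o \<Rightarrow> 'm"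
  assumes component: "A \<in> obj C \<Longrightarrow> \<phi> A \<in> hom1 C (on0 F A) (on0 G A)"
    and natural1: "f \<in> hom1 C A B \<Longrightarrow> on1 G f \<odot> \<phi> A = \<phi> B \<odot> on1 F f"
    and natural2: "\<lbrakk>f \<in> hom1 C A B; \<alpha> \<in> hom2 C f g\<rbrakk>
      \<Longrightarrow> on2 G \<alpha> \<lhd> \<phi> A = \<phi> B \<rhd> on2 F \<alpha>"

record ('o, 'm, 'c) monad = "('o, 'm, 'c) endo" +
  unit :: "'o \<Rightarrow> 'm"
  mult :: "'o \<Rightarrow> 'm"

locale two_monad =
  endo: endo_2_functor C R +
  unit: two_nat_trans C id_endo R "unit R" +
  mult: two_nat_trans C "comp_endo R R" R "mult R"
  for C :: "('o, 'm, 'c) two_cat" (structure) and R :: "('o, 'm, 'c) monad" +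
  assumes mult_unit_left: "A \<in> obj C \<Longrightarrow> mult R A \<odot> unit R (on0 R A) = id1 C (on0 R A)"
    and mult_unit_right: "A \<in> obj C \<Longrightarrow> mult R A \<odot> on1 R (unit R A) = id1 C (on0 R A)"
    and mult_assoc: "A \<in> obj C \<Longrightarrow>
      mult R A \<odot> mult R (on0 R A) = mult R A \<odot> on1 R (mult R A)"


section \<open>Distributive laws\<close>

text \<open>Beck's axioms for \<open>\<lambda> : ST \<Rightarrow> TS\<close>, written componentwise.\<close>

locale distributive_law =
  S: two_monad C S + T: two_monad C T +
  law: two_nat_trans C "comp_endo S T" "comp_endo T S" l
  for C :: "('o, 'm, 'c) two_cat" (structure)
    and S :: "('o, 'm, 'c) monad"
    and T :: "('o, 'm, 'c) monad"
    and l :: "'o \<Rightarrow> 'm" +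
  assumes law_unit_S: "A \<in> obj C \<Longrightarrow> l A \<odot> unit S (on0 T A) = on1 T (unit S A)"
    and law_unit_T: "A \<in> obj C \<Longrightarrow> l A \<odot> on1 S (unit T A) = unit T (on0 S A)"
    and law_mult_S: "A \<in> obj C \<Longrightarrow>
      l A \<odot> mult S (on0 T A) = on1 T (mult S A) \<odot> l (on0 S A) \<odot> on1 S (l A)"
    and law_mult_T: "A \<in> obj C \<Longrightarrow>
      l A \<odot> on1 S (mult T A) = mult T (on0 S A) \<odot> on1 T (l A) \<odot> l (on0 T A)"

text \<open>
  The 2-monad structure on \<open>TS\<close>: the unit is \<open>A \<rightarrow> SA \<rightarrow> TSA\<close> and the multiplication is
  \<open>TSTSA \<rightarrow> TTSSA \<rightarrow> TTSA \<rightarrow> TSA\<close>.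
\<close>

definition composite_monad ::
  "('o, 'm, 'c) two_cat \<Rightarrow> ('o, 'm, 'c) monad \<Rightarrow> ('o, 'm, 'c) monad \<Rightarrow> ('o \<Rightarrow> 'm)
    \<Rightarrow> ('o, 'm, 'c) monad" where
  "composite_monad C S T l =
    \<lparr>on0 = \<lambda>A. on0 T (on0 S A),
     on1 = \<lambda>f. on1 T (on1 S f),
     on2 = \<lambda>\<alpha>. on2 T (on2 S \<alpha>),
     unit = \<lambda>A. unit T (on0 S A) \<odot>\<^bsub>C\<^esub> unit S A,
     mult = \<lambda>A. mult T (on0 S A) \<odot>\<^bsub>C\<^esub> on1 T (on1 T (mult S A)) \<odot>\<^bsub>C\<^esub> on1 T (l (on0 S A))\<rparr>"


section \<open>Algebras, weak maps and transformations\<close>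

locale strict_algebra =
  fixes C :: "('o, 'm, 'c) two_cat" (structure)
    and R :: "('o, 'm, 'c) monad"
    and A :: 'o and a :: 'm
  assumes carrier_obj: "A \<in> obj C"
    and action_hom: "a \<in> hom1 C (on0 R A) A"
    and action_unit: "a \<odot> unit R A = id1 C A"
    and action_mult: "a \<odot> mult R A = a \<odot> on1 R a"

locale weak_map =
  A: strict_algebra C R A a + B: strict_algebra C R B b
  for C :: "('o, 'm, 'c) two_cat" (structure)
    and R :: "('o, 'm, 'c) monad"
    and A :: 'o and a :: 'm and B :: 'o and b :: 'm +
  fixes f :: 'm and \<rho> :: 'c
  assumes map_hom: "f \<in> hom1 C A B"
    and map_iso: "invertible_2cell C (b \<odot> on1 R f) (f \<odot> a) \<rho>"
    and map_mult: "(\<rho> \<lhd> on1 R a) \<cdot> (b \<rhd> on2 R \<rho>) = \<rho> \<lhd> mult R A"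
    and map_unit: "\<rho> \<lhd> unit R A = id2 C f"

locale alg_transformation =
  f: weak_map C R A a B b f \<rho> + g: weak_map C R A a B b g \<sigma>
  for C :: "('o, 'm, 'c) two_cat" (structure)
    and R :: "('o, 'm, 'c) monad"
    and A :: 'o and a :: 'm and B :: 'o and b :: 'm
    and f :: 'm and \<rho> :: 'c and g :: 'm and \<sigma> :: 'c +
  fixes \<alpha> :: 'c
  assumes cell_hom: "\<alpha> \<in> hom2 C f g"
    and cell_compat: "\<sigma> \<cdot> (b \<rhd> on2 R \<alpha>) = (\<alpha> \<lhd> a) \<cdot> \<rho>"

text \<open>
  The \<open>S\<close>- and \<open>T\<close>-algebra structures, and the corresponding structure 2-cells of weak maps,
  associated with a \<open>TS\<close>-algebra \<open>\<theta> : TSA \<rightarrow> A\<close> and a weak map with structure 2-cell \<open>\<zeta>\<close>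
  out of an algebra with underlying object \<open>A\<close>.
\<close>

definition action_S ::
  "('o, 'm, 'c) two_cat \<Rightarrow> ('o, 'm, 'c) monad \<Rightarrow> ('o, 'm, 'c) monad \<Rightarrow> 'o \<Rightarrow> 'm \<Rightarrow> 'm" where
  "action_S C S T A \<theta> = \<theta> \<odot>\<^bsub>C\<^esub> unit T (on0 S A)"

definition action_T ::
  "('o, 'm, 'c) two_cat \<Rightarrow> ('o, 'm, 'c) monad \<Rightarrow> ('o, 'm, 'c) monad \<Rightarrow> 'o \<Rightarrow> 'm \<Rightarrow> 'm" where
  "action_T C S T A \<theta> = \<theta> \<odot>\<^bsub>C\<^esub> on1 T (unit S A)"

definition weak_cell_S ::
  "('o, 'm, 'c) two_cat \<Rightarrow> ('o, 'm, 'c) monad \<Rightarrow> ('o, 'm, 'c) monad \<Rightarrow> 'o \<Rightarrow> 'c \<Rightarrow> 'c" where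
  "weak_cell_S C S T A \<zeta> = \<zeta> \<lhd>\<^bsub>C\<^esub> unit T (on0 S A)"

definition weak_cell_T ::
  "('o, 'm, 'c) two_cat \<Rightarrow> ('o, 'm, 'c) monad \<Rightarrow> ('o, 'm, 'c) monad \<Rightarrow> 'o \<Rightarrow> 'c \<Rightarrow> 'c" where
  "weak_cell_T C S T A \<zeta> = \<zeta> \<lhd>\<^bsub>C\<^esub> on1 T (unit S A)"

end

theory Submission
  imports Defs
begin

text \<open>
  Fix weak maps \<open>(f, \<rho>)\<close> and \<open>(g, \<sigma>)\<close> of algebras \<open>a : TSA \<rightarrow> A\<close> and \<open>b : TSB \<rightarrow> B\<close>, and a
  2-cell \<open>\<alpha> : f \<Rightarrow> g\<close>. The transformation axiom is an equation \<open>L = M\<close> between two 2-cells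
  out of \<open>TSA\<close>, where \<open>L = \<sigma> \<cdot> (b \<rhd> TS\<alpha>)\<close> and \<open>M = (\<alpha> \<lhd> a) \<cdot> \<rho>\<close>.

  The families \<open>\<eta>\<^sup>T\<^sub>S : S \<Rightarrow> TS\<close> and \<open>T\<eta>\<^sup>S : T \<Rightarrow> TS\<close> are maps of 2-monads (\<open>S_to_TS\<close>,
  \<open>T_to_TS\<close>), and the associated \<open>S\<close>- and \<open>T\<close>-structures are the restrictions along them. For any
  map of monads \<open>\<phi> : R \<Rightarrow> Q\<close>, restriction carries weak maps to weak maps
  (\<open>restrict_weak_map\<close>), and by naturality of \<open>\<phi>\<close> on 2-cells the transformation axiom
  for \<open>R\<close> is the axiom for \<open>Q\<close> whiskered with \<open>\<phi>\<^sub>A\<close>, that is, \<open>L \<lhd> \<phi>\<^sub>A = M \<lhd> \<phi>\<^sub>A\<close>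
  (\<open>restricted_compat_iff\<close>). Hence a transformation of \<open>TS\<close>-algebras is one of \<open>S\<close>-algebras
  and of \<open>T\<close>-algebras.

  Conversely, the two maps generate \<open>TS\<close>: the unit laws of \<open>\<lambda>\<close>, \<open>S\<close> and \<open>T\<close> show that
  the 1-cell \<open>n = TS\<eta>\<^sup>T\<^sub>S \<circ> T\<eta>\<^sup>S\<^sub>S : TS \<rightarrow> TSTS\<close> is a section of the multiplication
  (\<open>TS_generated\<close>). Whiskering the multiplicativity axiom of a weak map with \<open>n\<close> therefore
  decomposes its structure cell into its \<open>S\<close>-part followed by its \<open>T\<close>-part, so \<open>\<alpha>\<close> can be moved
  past one part and then past the other (\<open>compat_from_generating_maps\<close>).
\<close>


section \<open>Typing and whiskering in a strict 2-category\<close>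

text \<open>
  The laws are restated with the boundaries of cells as computed values instead of membership in
  hom-sets. Composability then becomes an equation between sources and targets, which the
  simplifier decides by evaluating the boundary of a composite recursively; membership in a
  hom-set would require it to guess the intermediate objects.
\<close>

context strict_2_category
begin

lemma hom1_iff: "f \<in> hom1 C X Y \<longleftrightarrow> f \<in> arr C \<and> src C f = X \<and> trg C f = Y"
  by (simp add: hom1_def)

lemma hom2_iff: "\<alpha> \<in> hom2 C f g \<longleftrightarrow> \<alpha> \<in> cell C \<and> dom2 C \<alpha> = f \<and> cod2 C \<alpha> = g"
  by (simp add: hom2_def)

lemma obj_src_trg [simp]:
  assumes "f \<in> arr C"
  shows "src C f \<in> obj C" "trg C f \<in> obj C"
  using assms by (auto intro: src_obj trg_obj)

lemma id1_typing [simp]: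
  assumes "A \<in> obj C"
  shows "id1 C A \<in> arr C" "src C (id1 C A) = A" "trg C (id1 C A) = A"
  using id1_hom[OF assms] by (auto simp: hom1_iff)

lemma comp1_typing [simp]:
  assumes "f \<in> arr C" "g \<in> arr C" "trg C f = src C g"
  shows "g \<odot> f \<in> arr C" "src C (g \<odot> f) = src C f" "trg C (g \<odot> f) = trg C g"
  using comp1_hom[of f "src C f" "trg C f" g "trg C g"] assms by (auto simp: hom1_iff)

lemma comp1_units [simp]:
  assumes "f \<in> arr C"
  shows "trg C f = X \<Longrightarrow> id1 C X \<odot> f = f" "src C f = X \<Longrightarrow> f \<odot> id1 C X = f"
  using comp1_id_left[of f] comp1_id_right[of f] assms by (auto simp: hom1_iff)

lemma comp1_assoc' [simp]:
  assumes "f \<in> arr C" "g \<in> arr C" "h \<in> arr C" "trg C f = src C g" "trg C g = src C h"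
  shows "(h \<odot> g) \<odot> f = h \<odot> (g \<odot> f)"
  using comp1_assoc[of f "src C f" "trg C f" g "trg C g" h "trg C h"] assms
  by (auto simp: hom1_iff)

lemma boundary_typing [simp]:
  assumes "\<alpha> \<in> cell C"
  shows "dom2 C \<alpha> \<in> arr C" "cod2 C \<alpha> \<in> arr C"
    "src C (cod2 C \<alpha>) = src C (dom2 C \<alpha>)" "trg C (cod2 C \<alpha>) = trg C (dom2 C \<alpha>)"
  using dom_arr cod_arr src_parallel trg_parallel assms by simp_all

lemma id2_typing [simp]:
  assumes "f \<in> arr C"
  shows "id2 C f \<in> cell C" "dom2 C (id2 C f) = f" "cod2 C (id2 C f) = f"
  using id2_hom[OF assms] by (auto simp: hom2_iff)

lemma vcomp_typing [simp]:
  assumes "\<alpha> \<in> cell C" "\<beta> \<in> cell C" "cod2 C \<alpha> = dom2 C \<beta>"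
  shows "\<beta> \<cdot> \<alpha> \<in> cell C" "dom2 C (\<beta> \<cdot> \<alpha>) = dom2 C \<alpha>" "cod2 C (\<beta> \<cdot> \<alpha>) = cod2 C \<beta>"
  using vcomp_hom[of \<alpha> "dom2 C \<alpha>" "cod2 C \<alpha>" \<beta> "cod2 C \<beta>"] assms by (auto simp: hom2_iff)

lemma vcomp_assoc':
  assumes "\<alpha> \<in> cell C" "\<beta> \<in> cell C" "\<gamma> \<in> cell C"
    "cod2 C \<alpha> = dom2 C \<beta>" "cod2 C \<beta> = dom2 C \<gamma>"
  shows "(\<gamma> \<cdot> \<beta>) \<cdot> \<alpha> = \<gamma> \<cdot> (\<beta> \<cdot> \<alpha>)"
  using vcomp_assoc[of \<alpha> "dom2 C \<alpha>" "cod2 C \<alpha>" \<beta> "cod2 C \<beta>" \<gamma> "cod2 C \<gamma>"] assms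
  by (auto simp: hom2_iff)

lemma hcomp_typing:
  assumes "\<alpha> \<in> cell C" "\<beta> \<in> cell C" "trg C (dom2 C \<alpha>) = src C (dom2 C \<beta>)"
  shows "\<beta> \<star> \<alpha> \<in> cell C" "dom2 C (\<beta> \<star> \<alpha>) = dom2 C \<beta> \<odot> dom2 C \<alpha>"
    "cod2 C (\<beta> \<star> \<alpha>) = cod2 C \<beta> \<odot> cod2 C \<alpha>"
  using hcomp_hom[of "dom2 C \<alpha>" "src C (dom2 C \<alpha>)" "trg C (dom2 C \<alpha>)" \<alpha> "cod2 C \<alpha>"
      "dom2 C \<beta>" "trg C (dom2 C \<beta>)" \<beta> "cod2 C \<beta>"] assms
  by (auto simp: hom1_iff hom2_iff)

lemma hcomp_assoc':
  assumes "\<alpha> \<in> cell C" "\<beta> \<in> cell C" "\<gamma> \<in> cell C"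
    "trg C (dom2 C \<alpha>) = src C (dom2 C \<beta>)" "trg C (dom2 C \<beta>) = src C (dom2 C \<gamma>)"
  shows "(\<gamma> \<star> \<beta>) \<star> \<alpha> = \<gamma> \<star> (\<beta> \<star> \<alpha>)"
  using hcomp_assoc[of "dom2 C \<alpha>" "src C (dom2 C \<alpha>)" "trg C (dom2 C \<alpha>)" \<alpha> "cod2 C \<alpha>"
      "dom2 C \<beta>" "trg C (dom2 C \<beta>)" \<beta> "cod2 C \<beta>" "dom2 C \<gamma>" "trg C (dom2 C \<gamma>)" \<gamma> "cod2 C \<gamma>"]
    assms
  by (auto simp: hom1_iff hom2_iff)

lemma hcomp_id2':
  assumes "f \<in> arr C" "g \<in> arr C" "trg C f = src C g"
  shows "id2 C g \<star> id2 C f = id2 C (g \<odot> f)"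
  using hcomp_id2[of f "src C f" "trg C f" g "trg C g"] assms by (auto simp: hom1_iff)

lemma interchange':
  assumes "\<alpha> \<in> cell C" "\<alpha>' \<in> cell C" "\<beta> \<in> cell C" "\<beta>' \<in> cell C"
    "cod2 C \<alpha> = dom2 C \<alpha>'" "cod2 C \<beta> = dom2 C \<beta>'" "trg C (dom2 C \<alpha>) = src C (dom2 C \<beta>)"
  shows "(\<beta>' \<cdot> \<beta>) \<star> (\<alpha>' \<cdot> \<alpha>) = (\<beta>' \<star> \<alpha>') \<cdot> (\<beta> \<star> \<alpha>)"
  using interchange[of "dom2 C \<alpha>" "src C (dom2 C \<alpha>)" "trg C (dom2 C \<alpha>)" \<alpha> "cod2 C \<alpha>" \<alpha>'
      "cod2 C \<alpha>'" "dom2 C \<beta>" "trg C (dom2 C \<beta>)" \<beta> "cod2 C \<beta>" \<beta>' "cod2 C \<beta>'"] assms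
  by (auto simp: hom1_iff hom2_iff)

lemma vcomp_units [simp]:
  assumes "\<alpha> \<in> cell C"
  shows "cod2 C \<alpha> = f \<Longrightarrow> id2 C f \<cdot> \<alpha> = \<alpha>" "dom2 C \<alpha> = f \<Longrightarrow> \<alpha> \<cdot> id2 C f = \<alpha>"
  using vcomp_id_left[of \<alpha>] vcomp_id_right[of \<alpha>] assms by (auto simp: hom2_iff)

lemma whisker_right_typing [simp]:
  assumes "\<alpha> \<in> cell C" "h \<in> arr C" "trg C h = src C (dom2 C \<alpha>)"
  shows "\<alpha> \<lhd> h \<in> cell C" "dom2 C (\<alpha> \<lhd> h) = dom2 C \<alpha> \<odot> h" "cod2 C (\<alpha> \<lhd> h) = cod2 C \<alpha> \<odot> h"
  using hcomp_typing[of "id2 C h" \<alpha>] assms by (simp_all add: whisker_right_def)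

lemma whisker_left_typing [simp]:
  assumes "\<alpha> \<in> cell C" "h \<in> arr C" "src C h = trg C (dom2 C \<alpha>)"
  shows "h \<rhd> \<alpha> \<in> cell C" "dom2 C (h \<rhd> \<alpha>) = h \<odot> dom2 C \<alpha>" "cod2 C (h \<rhd> \<alpha>) = h \<odot> cod2 C \<alpha>"
  using hcomp_typing[of \<alpha> "id2 C h"] assms by (simp_all add: whisker_left_def)

lemma whisker_right_id1 [simp]:
  assumes "\<alpha> \<in> cell C" "src C (dom2 C \<alpha>) = X"
  shows "\<alpha> \<lhd> id1 C X = \<alpha>"
  using hcomp_id_right[of "dom2 C \<alpha>" X "trg C (dom2 C \<alpha>)" \<alpha>] assms
  by (auto simp: whisker_right_def hom1_iff hom2_iff)

lemma whisker_right_id2 [simp]: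
  assumes "f \<in> arr C" "h \<in> arr C" "trg C h = src C f"
  shows "id2 C f \<lhd> h = id2 C (f \<odot> h)"
  using assms by (simp add: whisker_right_def hcomp_id2')

lemma whisker_right_vcomp:
  assumes "\<alpha> \<in> cell C" "\<beta> \<in> cell C" "cod2 C \<alpha> = dom2 C \<beta>" "h \<in> arr C" "trg C h = src C (dom2 C \<alpha>)"
  shows "(\<beta> \<cdot> \<alpha>) \<lhd> h = (\<beta> \<lhd> h) \<cdot> (\<alpha> \<lhd> h)"
  using interchange'[of "id2 C h" "id2 C h" \<alpha> \<beta>] assms by (simp add: whisker_right_def)

lemma whisker_left_vcomp:
  assumes "\<alpha> \<in> cell C" "\<beta> \<in> cell C" "cod2 C \<alpha> = dom2 C \<beta>" "h \<in> arr C" "src C h = trg C (dom2 C \<alpha>)"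
  shows "h \<rhd> (\<beta> \<cdot> \<alpha>) = (h \<rhd> \<beta>) \<cdot> (h \<rhd> \<alpha>)"
  using interchange'[of \<alpha> \<beta> "id2 C h" "id2 C h"] assms by (simp add: whisker_left_def)

lemma whisker_right_comp1:
  assumes "\<alpha> \<in> cell C" "h \<in> arr C" "k \<in> arr C" "trg C h = src C (dom2 C \<alpha>)" "trg C k = src C h"
  shows "\<alpha> \<lhd> h \<lhd> k = \<alpha> \<lhd> (h \<odot> k)"
  using assms by (simp add: whisker_right_def hcomp_assoc' hcomp_id2')

lemma whisker_left_comp1:
  assumes "\<alpha> \<in> cell C" "h \<in> arr C" "k \<in> arr C" "src C h = trg C (dom2 C \<alpha>)" "src C k = trg C h"
  shows "k \<rhd> (h \<rhd> \<alpha>) = (k \<odot> h) \<rhd> \<alpha>"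
  using assms by (simp add: whisker_left_def hcomp_assoc'[symmetric] hcomp_id2')

lemma whisker_left_right:
  assumes "\<alpha> \<in> cell C" "h \<in> arr C" "k \<in> arr C" "src C h = trg C (dom2 C \<alpha>)"
    "trg C k = src C (dom2 C \<alpha>)"
  shows "(h \<rhd> \<alpha>) \<lhd> k = h \<rhd> (\<alpha> \<lhd> k)"
  using assms by (simp add: whisker_left_def whisker_right_def hcomp_assoc')

end

context endo_2_functor
begin

lemma on0_obj' [simp]: "A \<in> obj C \<Longrightarrow> on0 F A \<in> obj C"
  by (rule on0_obj)

lemma on1_typing [simp]:
  assumes "f \<in> arr C"
  shows "on1 F f \<in> arr C" "src C (on1 F f) = on0 F (src C f)" "trg C (on1 F f) = on0 F (trg C f)"
  using on1_hom[of f "src C f" "trg C f"] assms by (auto simp: hom1_iff)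

lemma on1_comp1:
  assumes "f \<in> arr C" "g \<in> arr C" "trg C f = src C g"
  shows "on1 F (g \<odot> f) = on1 F g \<odot> on1 F f"
  using on1_comp[of f "src C f" "trg C f" g "trg C g"] assms by (auto simp: hom1_iff)

lemma on2_typing [simp]:
  assumes "\<alpha> \<in> cell C"
  shows "on2 F \<alpha> \<in> cell C" "dom2 C (on2 F \<alpha>) = on1 F (dom2 C \<alpha>)"
    "cod2 C (on2 F \<alpha>) = on1 F (cod2 C \<alpha>)"
  using on2_hom[of \<alpha> "dom2 C \<alpha>" "cod2 C \<alpha>"] assms by (auto simp: hom2_iff)

lemma on2_vcomp':
  assumes "\<alpha> \<in> cell C" "\<beta> \<in> cell C" "cod2 C \<alpha> = dom2 C \<beta>"
  shows "on2 F (\<beta> \<cdot> \<alpha>) = on2 F \<beta> \<cdot> on2 F \<alpha>"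
  using on2_vcomp[of \<alpha> "dom2 C \<alpha>" "cod2 C \<alpha>" \<beta> "cod2 C \<beta>"] assms by (auto simp: hom2_iff)

lemma on2_hcomp':
  assumes "\<alpha> \<in> cell C" "\<beta> \<in> cell C" "trg C (dom2 C \<alpha>) = src C (dom2 C \<beta>)"
  shows "on2 F (\<beta> \<star> \<alpha>) = on2 F \<beta> \<star> on2 F \<alpha>"
  using on2_hcomp[of "dom2 C \<alpha>" "src C (dom2 C \<alpha>)" "trg C (dom2 C \<alpha>)" \<alpha> "cod2 C \<alpha>"
      "dom2 C \<beta>" "trg C (dom2 C \<beta>)" \<beta> "cod2 C \<beta>"] assms
  by (auto simp: hom1_iff hom2_iff)

lemma on2_whisker_right:
  assumes "\<alpha> \<in> cell C" "h \<in> arr C" "trg C h = src C (dom2 C \<alpha>)"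
  shows "on2 F (\<alpha> \<lhd> h) = on2 F \<alpha> \<lhd> on1 F h"
  using assms by (simp add: whisker_right_def on2_hcomp' on2_id)

lemma on2_whisker_left:
  assumes "\<alpha> \<in> cell C" "h \<in> arr C" "src C h = trg C (dom2 C \<alpha>)"
  shows "on2 F (h \<rhd> \<alpha>) = on1 F h \<rhd> on2 F \<alpha>"
  using assms by (simp add: whisker_left_def on2_hcomp' on2_id)

end

context two_nat_trans
begin

lemma component_typing [simp]:
  assumes "A \<in> obj C"
  shows "\<phi> A \<in> arr C" "src C (\<phi> A) = on0 F A" "trg C (\<phi> A) = on0 G A"
  using component[OF assms] by (auto simp: F.hom1_iff)

lemma natural1':
  assumes "f \<in> arr C" "src C f = A" "trg C f = B"
  shows "on1 G f \<odot> \<phi> A = \<phi> B \<odot> on1 F f"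
  using natural1[of f A B] assms by (auto simp: F.hom1_iff)

lemma natural2':
  assumes "\<alpha> \<in> cell C" "src C (dom2 C \<alpha>) = A" "trg C (dom2 C \<alpha>) = B"
  shows "on2 G \<alpha> \<lhd> \<phi> A = \<phi> B \<rhd> on2 F \<alpha>"
  using natural2[of "dom2 C \<alpha>" A B \<alpha> "cod2 C \<alpha>"] assms by (auto simp: F.hom1_iff F.hom2_iff)

end


section \<open>Restriction along a map of monads\<close>

text \<open>
  The right-hand side of the multiplication law uses one of the two equal forms
  \<open>Q\<phi> \<circ> \<phi>\<^sub>R = \<phi>\<^sub>Q \<circ> R\<phi>\<close> of the horizontal composite \<open>RR \<Rightarrow> QQ\<close>. In this form the factor
  \<open>Q\<phi>\<close> stands directly behind \<open>Q\<close> applied to an action or a structure cell, where it can be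
  absorbed by functoriality.
\<close>

locale monad_map = two_nat_trans C R Q \<phi>
  for C :: "('o, 'm, 'c) two_cat" (structure)
    and R Q :: "('o, 'm, 'c) monad"
    and \<phi> :: "'o \<Rightarrow> 'm" +
  assumes unit_hom: "A \<in> obj C \<Longrightarrow> unit R A \<in> hom1 C A (on0 R A)"
    and mult_hom: "A \<in> obj C \<Longrightarrow> mult R A \<in> hom1 C (on0 R (on0 R A)) (on0 R A)"
    and mult_hom': "A \<in> obj C \<Longrightarrow> mult Q A \<in> hom1 C (on0 Q (on0 Q A)) (on0 Q A)"
    and map_unit: "A \<in> obj C \<Longrightarrow> \<phi> A \<odot> unit R A = unit Q A"
    and map_mult: "A \<in> obj C \<Longrightarrow>
      \<phi> A \<odot> mult R A = mult Q A \<odot> on1 Q (\<phi> A) \<odot> \<phi> (on0 R A)"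
begin

lemma unit_mult_typing [simp]:
  assumes "A \<in> obj C"
  shows "unit R A \<in> arr C" "src C (unit R A) = A" "trg C (unit R A) = on0 R A"
    "mult R A \<in> arr C" "src C (mult R A) = on0 R (on0 R A)" "trg C (mult R A) = on0 R A"
    "mult Q A \<in> arr C" "src C (mult Q A) = on0 Q (on0 Q A)" "trg C (mult Q A) = on0 Q A"
  using unit_hom[OF assms] mult_hom[OF assms] mult_hom'[OF assms] by (auto simp: F.hom1_iff)

lemma restricted_square:
  assumes "A \<in> obj C" "a \<in> arr C" "src C a = on0 Q A" "trg C a = A"
  shows "\<phi> A \<odot> on1 R (a \<odot> \<phi> A) = on1 Q a \<odot> on1 Q (\<phi> A) \<odot> \<phi> (on0 R A)"
proof -
  have "\<phi> A \<odot> on1 R (a \<odot> \<phi> A) = on1 Q (a \<odot> \<phi> A) \<odot> \<phi> (on0 R A)"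
    using assms by (intro natural1'[symmetric]) simp_all
  then show ?thesis
    using assms by (simp add: G.on1_comp1)
qed

lemma restrict_algebra:
  assumes "strict_algebra C Q A a"
  shows "strict_algebra C R A (a \<odot> \<phi> A)"
proof -
  interpret a: strict_algebra C Q A a by fact
  have [simp]: "A \<in> obj C" "a \<in> arr C" "src C a = on0 Q A" "trg C a = A"
    using a.carrier_obj a.action_hom by (auto simp: F.hom1_iff)
  show ?thesis
  proof
    show "A \<in> obj C" "a \<odot> \<phi> A \<in> hom1 C (on0 R A) A"
      by (simp_all add: F.hom1_iff)
    show "(a \<odot> \<phi> A) \<odot> unit R A = id1 C A"
      by (simp add: map_unit a.action_unit)
    have "(a \<odot> \<phi> A) \<odot> mult R A = (a \<odot> mult Q A) \<odot> on1 Q (\<phi> A) \<odot> \<phi> (on0 R A)"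
      by (simp add: map_mult)
    also have "\<dots> = a \<odot> (\<phi> A \<odot> on1 R (a \<odot> \<phi> A))"
      by (simp add: a.action_mult restricted_square)
    finally show "(a \<odot> \<phi> A) \<odot> mult R A = (a \<odot> \<phi> A) \<odot> on1 R (a \<odot> \<phi> A)"
      by simp
  qed
qed

text \<open>
  Naturality of \<open>\<phi>\<close> on the 2-cell \<open>\<rho> \<lhd> \<phi>\<^sub>A\<close> turns the multiplicativity axiom for the
  restriction into that for \<open>\<rho>\<close> whiskered with \<open>Q\<phi>\<^sub>A \<circ> \<phi>\<^sub>R\<^sub>A\<close>. Whiskering preserves vertical
  composites, so it also preserves the inverse of \<open>\<rho>\<close>.
\<close>

lemma restrict_weak_map:
  assumes "weak_map C Q A a B b f \<rho>"
  shows "weak_map C R A (a \<odot> \<phi> A) B (b \<odot> \<phi> B) f (\<rho> \<lhd> \<phi> A)"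
proof -
  interpret f: weak_map C Q A a B b f \<rho> by fact
  have [simp]: "A \<in> obj C" "a \<in> arr C" "src C a = on0 Q A" "trg C a = A"
    using f.A.carrier_obj f.A.action_hom by (auto simp: F.hom1_iff)
  have [simp]: "B \<in> obj C" "b \<in> arr C" "src C b = on0 Q B" "trg C b = B"
    using f.B.carrier_obj f.B.action_hom by (auto simp: F.hom1_iff)
  have [simp]: "f \<in> arr C" "src C f = A" "trg C f = B"
    using f.map_hom by (auto simp: F.hom1_iff)
  obtain \<rho>' where rho': "\<rho>' \<in> hom2 C (f \<odot> a) (b \<odot> on1 Q f)"
      "\<rho>' \<cdot> \<rho> = id2 C (b \<odot> on1 Q f)" "\<rho> \<cdot> \<rho>' = id2 C (f \<odot> a)"
    and "\<rho> \<in> hom2 C (b \<odot> on1 Q f) (f \<odot> a)"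
    using f.map_iso by (auto simp: invertible_2cell_def)
  then have [simp]: "\<rho> \<in> cell C" "dom2 C \<rho> = b \<odot> on1 Q f" "cod2 C \<rho> = f \<odot> a"
    "\<rho>' \<in> cell C" "dom2 C \<rho>' = f \<odot> a" "cod2 C \<rho>' = b \<odot> on1 Q f"
    by (auto simp: F.hom2_iff)
  have nat: "on1 Q f \<odot> \<phi> A = \<phi> B \<odot> on1 R f"
    by (rule natural1') simp_all
  have "(\<rho>' \<lhd> \<phi> A) \<cdot> (\<rho> \<lhd> \<phi> A) = (\<rho>' \<cdot> \<rho>) \<lhd> \<phi> A"
    "(\<rho> \<lhd> \<phi> A) \<cdot> (\<rho>' \<lhd> \<phi> A) = (\<rho> \<cdot> \<rho>') \<lhd> \<phi> A"
    by (simp_all add: F.whisker_right_vcomp)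
  then have iso: "invertible_2cell C ((b \<odot> \<phi> B) \<odot> on1 R f) (f \<odot> (a \<odot> \<phi> A)) (\<rho> \<lhd> \<phi> A)"
    unfolding invertible_2cell_def
    by (intro conjI bexI[of _ "\<rho>' \<lhd> \<phi> A"]) (simp_all add: F.hom2_iff rho' nat)
  let ?k = "on1 Q (\<phi> A) \<odot> \<phi> (on0 R A)"
  have "\<phi> B \<rhd> on2 R (\<rho> \<lhd> \<phi> A) = on2 Q (\<rho> \<lhd> \<phi> A) \<lhd> \<phi> (on0 R A)"
    by (intro natural2'[symmetric]) simp_all
  also have "\<dots> = on2 Q \<rho> \<lhd> ?k"
    by (simp add: G.on2_whisker_right F.whisker_right_comp1)
  finally have "(b \<odot> \<phi> B) \<rhd> on2 R (\<rho> \<lhd> \<phi> A) = (b \<rhd> on2 Q \<rho>) \<lhd> ?k"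
    by (simp add: F.whisker_left_comp1[symmetric] F.whisker_left_right)
  moreover have "\<rho> \<lhd> \<phi> A \<lhd> on1 R (a \<odot> \<phi> A) = \<rho> \<lhd> on1 Q a \<lhd> ?k"
    by (simp add: F.whisker_right_comp1 restricted_square)
  ultimately have "(\<rho> \<lhd> \<phi> A \<lhd> on1 R (a \<odot> \<phi> A)) \<cdot> ((b \<odot> \<phi> B) \<rhd> on2 R (\<rho> \<lhd> \<phi> A))
      = ((\<rho> \<lhd> on1 Q a) \<cdot> (b \<rhd> on2 Q \<rho>)) \<lhd> ?k"
    by (simp add: F.whisker_right_vcomp G.on1_comp1)
  also have "\<dots> = \<rho> \<lhd> \<phi> A \<lhd> mult R A"
    by (simp add: f.map_mult F.whisker_right_comp1 map_mult)
  finally have mult: "(\<rho> \<lhd> \<phi> A \<lhd> on1 R (a \<odot> \<phi> A)) \<cdot> ((b \<odot> \<phi> B) \<rhd> on2 R (\<rho> \<lhd> \<phi> A))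
      = \<rho> \<lhd> \<phi> A \<lhd> mult R A" .
  have "\<rho> \<lhd> \<phi> A \<lhd> unit R A = id2 C f"
    by (simp add: F.whisker_right_comp1 map_unit f.map_unit)
  with iso mult f.map_hom show ?thesis
    by (intro weak_map.intro weak_map_axioms.intro restrict_algebra
        f.A.strict_algebra_axioms f.B.strict_algebra_axioms)
qed

text \<open>
  By naturality, \<open>\<phi>\<^sub>B \<rhd> R\<alpha> = Q\<alpha> \<lhd> \<phi>\<^sub>A\<close>, so each side of the axiom for \<open>R\<close> is the corresponding
  side of the axiom for \<open>Q\<close> whiskered with \<open>\<phi>\<^sub>A\<close>.
\<close>

lemma restricted_compat_iff:
  assumes "weak_map C Q A a B b f \<rho>" "weak_map C Q A a B b g \<sigma>" "\<alpha> \<in> hom2 C f g"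
  shows "alg_transformation C R A (a \<odot> \<phi> A) B (b \<odot> \<phi> B) f (\<rho> \<lhd> \<phi> A) g (\<sigma> \<lhd> \<phi> A) \<alpha> \<longleftrightarrow>
    (\<sigma> \<cdot> (b \<rhd> on2 Q \<alpha>)) \<lhd> \<phi> A = ((\<alpha> \<lhd> a) \<cdot> \<rho>) \<lhd> \<phi> A"
proof -
  interpret f: weak_map C Q A a B b f \<rho> by fact
  interpret g: weak_map C Q A a B b g \<sigma> by fact
  have [simp]: "A \<in> obj C" "a \<in> arr C" "src C a = on0 Q A" "trg C a = A"
    "B \<in> obj C" "b \<in> arr C" "src C b = on0 Q B" "trg C b = B"
    "f \<in> arr C" "src C f = A" "trg C f = B" "g \<in> arr C" "src C g = A" "trg C g = B"
    "\<alpha> \<in> cell C" "dom2 C \<alpha> = f" "cod2 C \<alpha> = g"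
    "\<rho> \<in> cell C" "dom2 C \<rho> = b \<odot> on1 Q f" "cod2 C \<rho> = f \<odot> a"
    "\<sigma> \<in> cell C" "dom2 C \<sigma> = b \<odot> on1 Q g" "cod2 C \<sigma> = g \<odot> a"
    using f.A.carrier_obj f.A.action_hom f.B.carrier_obj f.B.action_hom f.map_hom g.map_hom
      f.map_iso g.map_iso assms(3)
    by (auto simp: F.hom1_iff F.hom2_iff invertible_2cell_def)
  have "(b \<odot> \<phi> B) \<rhd> on2 R \<alpha> = b \<rhd> (\<phi> B \<rhd> on2 R \<alpha>)"
    by (simp add: F.whisker_left_comp1)
  also have "\<dots> = (b \<rhd> on2 Q \<alpha>) \<lhd> \<phi> A"
    by (simp add: natural2'[symmetric] F.whisker_left_right)
  finally have "(\<sigma> \<lhd> \<phi> A) \<cdot> ((b \<odot> \<phi> B) \<rhd> on2 R \<alpha>) = (\<sigma> \<cdot> (b \<rhd> on2 Q \<alpha>)) \<lhd> \<phi> A"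
    by (simp add: F.whisker_right_vcomp)
  moreover have "(\<alpha> \<lhd> (a \<odot> \<phi> A)) \<cdot> (\<rho> \<lhd> \<phi> A) = ((\<alpha> \<lhd> a) \<cdot> \<rho>) \<lhd> \<phi> A"
    by (simp add: F.whisker_right_vcomp F.whisker_right_comp1)
  ultimately show ?thesis
    using assms restrict_weak_map[OF assms(1)] restrict_weak_map[OF assms(2)]
    by (auto simp: alg_transformation_def alg_transformation_axioms_def)
qed

end


section \<open>Two jointly generating maps of monads\<close>

text \<open>
  Suppose that \<open>Q = PR\<close> on objects and 2-cells, and that \<open>n\<^sub>X = Q\<phi>\<^sub>X \<circ> \<psi>\<^sub>R\<^sub>X\<close> is a section of the
  multiplication of \<open>Q\<close>. Then \<open>a = a \<circ> Qa \<circ> n\<^sub>A\<close>, which says that \<open>a\<close> is the restricted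
  \<open>P\<close>-action after \<open>P\<close> applied to the restricted \<open>R\<close>-action, and likewise
  \<open>\<rho> = (\<rho> \<lhd> Qa \<circ> n\<^sub>A) \<cdot> ((b \<rhd> Q\<rho>) \<lhd> n\<^sub>A)\<close>. In the factor \<open>b \<rhd> Q(-)\<close> whiskered with \<open>n\<^sub>A\<close>,
  only the whiskering with \<open>\<phi>\<^sub>A\<close> of its argument matters, and \<open>Qa \<circ> n\<^sub>A\<close> factors through \<open>\<psi>\<^sub>A\<close>.
  The two hypotheses apply in these two places.
\<close>

lemma compat_from_generating_maps:
  fixes C :: "('o, 'm, 'c) two_cat" (structure)
  assumes "monad_map C R Q \<phi>" "monad_map C P Q \<psi>"
    and "weak_map C Q A a B b f \<rho>" "weak_map C Q A a B b g \<sigma>" "\<alpha> \<in> hom2 C f g"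
    and compat_R: "(\<sigma> \<cdot> (b \<rhd> on2 Q \<alpha>)) \<lhd> \<phi> A = ((\<alpha> \<lhd> a) \<cdot> \<rho>) \<lhd> \<phi> A"
    and compat_P: "(\<sigma> \<cdot> (b \<rhd> on2 Q \<alpha>)) \<lhd> \<psi> A = ((\<alpha> \<lhd> a) \<cdot> \<rho>) \<lhd> \<psi> A"
    and on0: "\<And>X. X \<in> obj C \<Longrightarrow> on0 P (on0 R X) = on0 Q X"
    and on2: "\<And>\<alpha>. \<alpha> \<in> cell C \<Longrightarrow> on2 P (on2 R \<alpha>) = on2 Q \<alpha>"
    and gen: "\<And>X. X \<in> obj C \<Longrightarrow> mult Q X \<odot> on1 Q (\<phi> X) \<odot> \<psi> (on0 R X) = id1 C (on0 Q X)"
  shows "\<sigma> \<cdot> (b \<rhd> on2 Q \<alpha>) = (\<alpha> \<lhd> a) \<cdot> \<rho>"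
proof -
  interpret R: monad_map C R Q \<phi> by fact
  interpret P: monad_map C P Q \<psi> by fact
  interpret f: weak_map C Q A a B b f \<rho> by fact
  interpret g: weak_map C Q A a B b g \<sigma> by fact
  note [simp] = on0
  have [simp]: "A \<in> obj C" "a \<in> arr C" "src C a = on0 Q A" "trg C a = A"
    "B \<in> obj C" "b \<in> arr C" "src C b = on0 Q B" "trg C b = B"
    "f \<in> arr C" "src C f = A" "trg C f = B" "g \<in> arr C" "src C g = A" "trg C g = B"
    "\<alpha> \<in> cell C" "dom2 C \<alpha> = f" "cod2 C \<alpha> = g"
    "\<rho> \<in> cell C" "dom2 C \<rho> = b \<odot> on1 Q f" "cod2 C \<rho> = f \<odot> a"
    "\<sigma> \<in> cell C" "dom2 C \<sigma> = b \<odot> on1 Q g" "cod2 C \<sigma> = g \<odot> a"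
    using f.A.carrier_obj f.A.action_hom f.B.carrier_obj f.B.action_hom f.map_hom g.map_hom
      f.map_iso g.map_iso assms(5)
    by (auto simp: R.F.hom1_iff R.F.hom2_iff invertible_2cell_def)
  define L where "L = \<sigma> \<cdot> (b \<rhd> on2 Q \<alpha>)"
  define M where "M = (\<alpha> \<lhd> a) \<cdot> \<rho>"
  have [simp]: "L \<in> cell C" "dom2 C L = b \<odot> on1 Q f" "cod2 C L = g \<odot> a"
    "M \<in> cell C" "dom2 C M = b \<odot> on1 Q f" "cod2 C M = g \<odot> a"
    by (simp_all add: L_def M_def)
  define n where "n X = on1 Q (\<phi> X) \<odot> \<psi> (on0 R X)" for X
  have n [simp]: "n X \<in> arr C" "src C (n X) = on0 Q X" "trg C (n X) = on0 Q (on0 Q X)"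
    if "X \<in> obj C" for X
    using that by (simp_all add: n_def)
  have mult_n: "mult Q X \<odot> n X = id1 C (on0 Q X)" if "X \<in> obj C" for X
    using gen[OF that] that by (simp add: n_def)
  have action_n: "c \<odot> on1 Q c \<odot> n X = c" if "strict_algebra C Q X c" for X c
  proof -
    interpret c: strict_algebra C Q X c by fact
    have [simp]: "X \<in> obj C" "c \<in> arr C" "src C c = on0 Q X" "trg C c = X"
      using c.carrier_obj c.action_hom by (auto simp: R.F.hom1_iff)
    have "c \<odot> on1 Q c \<odot> n X = (c \<odot> on1 Q c) \<odot> n X" by simp
    also have "\<dots> = (c \<odot> mult Q X) \<odot> n X" by (simp add: c.action_mult)
    also have "\<dots> = c" by (simp add: mult_n)
    finally show ?thesis .
  qed
  have cell_n: "\<tau> = (\<tau> \<lhd> on1 Q a \<lhd> n A) \<cdot> ((b \<rhd> on2 Q \<tau>) \<lhd> n A)"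
    if "weak_map C Q A a B b h \<tau>" for h \<tau>
  proof -
    interpret h: weak_map C Q A a B b h \<tau> by fact
    have [simp]: "h \<in> arr C" "src C h = A" "trg C h = B"
      "\<tau> \<in> cell C" "dom2 C \<tau> = b \<odot> on1 Q h" "cod2 C \<tau> = h \<odot> a"
      using h.map_hom h.map_iso by (auto simp: R.F.hom1_iff R.F.hom2_iff invertible_2cell_def)
    have "\<tau> = \<tau> \<lhd> mult Q A \<lhd> n A"
      by (simp add: R.F.whisker_right_comp1 mult_n)
    also have "\<dots> = ((\<tau> \<lhd> on1 Q a) \<cdot> (b \<rhd> on2 Q \<tau>)) \<lhd> n A"
      by (simp add: h.map_mult)
    also have "\<dots> = (\<tau> \<lhd> on1 Q a \<lhd> n A) \<cdot> ((b \<rhd> on2 Q \<tau>) \<lhd> n A)"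
      by (simp add: R.F.whisker_right_vcomp R.G.on1_comp1)
    finally show ?thesis .
  qed
  have n_natural: "n B \<rhd> on2 Q \<alpha> = on2 Q (on2 Q \<alpha>) \<lhd> n A"
  proof -
    have "n B \<rhd> on2 Q \<alpha> = on1 Q (\<phi> B) \<rhd> (\<psi> (on0 R B) \<rhd> on2 P (on2 R \<alpha>))"
      by (simp add: n_def R.F.whisker_left_comp1 on2)
    also have "\<psi> (on0 R B) \<rhd> on2 P (on2 R \<alpha>) = on2 Q (on2 R \<alpha>) \<lhd> \<psi> (on0 R A)"
      by (intro P.natural2'[symmetric]) simp_all
    also have "on1 Q (\<phi> B) \<rhd> (on2 Q (on2 R \<alpha>) \<lhd> \<psi> (on0 R A))
        = on2 Q (\<phi> B \<rhd> on2 R \<alpha>) \<lhd> \<psi> (on0 R A)"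
      by (simp add: R.F.whisker_left_right[symmetric] R.G.on2_whisker_left)
    also have "\<phi> B \<rhd> on2 R \<alpha> = on2 Q \<alpha> \<lhd> \<phi> A"
      by (intro R.natural2'[symmetric]) simp_all
    also have "on2 Q (on2 Q \<alpha> \<lhd> \<phi> A) \<lhd> \<psi> (on0 R A) = on2 Q (on2 Q \<alpha>) \<lhd> n A"
      by (simp add: n_def R.G.on2_whisker_right R.F.whisker_right_comp1)
    finally show ?thesis .
  qed
  have on2_L: "on2 Q L = on2 Q \<sigma> \<cdot> (on1 Q b \<rhd> on2 Q (on2 Q \<alpha>))"
    by (simp add: L_def R.G.on2_vcomp' R.G.on2_whisker_left)
  have on2_M: "on2 Q M = (on2 Q \<alpha> \<lhd> on1 Q a) \<cdot> on2 Q \<rho>"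
    by (simp add: M_def R.G.on2_vcomp' R.G.on2_whisker_right)
  \<comment> \<open>The cell \<open>\<sigma>\<close> and the action \<open>b\<close> are decomposed first; naturality of \<open>n\<close> then moves \<open>\<alpha>\<close>
    under two applications of \<open>Q\<close>, where it meets the inner part of \<open>\<sigma>\<close>.\<close>
  have "L = ((\<sigma> \<lhd> on1 Q a \<lhd> n A) \<cdot> ((b \<rhd> on2 Q \<sigma>) \<lhd> n A)) \<cdot> ((b \<odot> on1 Q b \<odot> n B) \<rhd> on2 Q \<alpha>)"
    unfolding L_def
    by (simp only: cell_n[OF assms(4), symmetric] action_n[OF f.B.strict_algebra_axioms])
  also have "(b \<odot> on1 Q b \<odot> n B) \<rhd> on2 Q \<alpha> = (b \<rhd> (on1 Q b \<rhd> on2 Q (on2 Q \<alpha>))) \<lhd> n A"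
    by (simp add: R.F.whisker_left_comp1[symmetric] n_natural R.F.whisker_left_right)
  also have "((\<sigma> \<lhd> on1 Q a \<lhd> n A) \<cdot> ((b \<rhd> on2 Q \<sigma>) \<lhd> n A)) \<cdot> \<dots>
      = (\<sigma> \<lhd> on1 Q a \<lhd> n A) \<cdot> ((b \<rhd> on2 Q L) \<lhd> n A)"
    by (simp add: on2_L R.F.whisker_left_vcomp R.F.whisker_right_vcomp R.F.vcomp_assoc'
        R.G.on1_comp1)
  also have "(b \<rhd> on2 Q L) \<lhd> n A = (b \<rhd> on2 Q (L \<lhd> \<phi> A)) \<lhd> \<psi> (on0 R A)"
    by (simp add: n_def R.G.on2_whisker_right R.F.whisker_left_right R.F.whisker_right_comp1)
  also have "L \<lhd> \<phi> A = M \<lhd> \<phi> A"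
    unfolding L_def M_def by (rule compat_R)
  also have "(b \<rhd> on2 Q (M \<lhd> \<phi> A)) \<lhd> \<psi> (on0 R A) = (b \<rhd> on2 Q M) \<lhd> n A"
    by (simp add: n_def R.G.on2_whisker_right R.F.whisker_left_right R.F.whisker_right_comp1)
  \<comment> \<open>Now \<open>\<alpha>\<close> has passed the inner part, and the outer part of \<open>\<sigma>\<close> combines with it
    to another copy of \<open>L\<close>.\<close>
  also have "(\<sigma> \<lhd> on1 Q a \<lhd> n A) \<cdot> ((b \<rhd> on2 Q M) \<lhd> n A)
      = (L \<lhd> (on1 Q a \<odot> n A)) \<cdot> ((b \<rhd> on2 Q \<rho>) \<lhd> n A)"
    by (simp add: on2_M L_def R.F.whisker_left_vcomp R.F.whisker_right_vcomp R.F.vcomp_assoc'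
        R.G.on1_comp1 R.F.whisker_left_right R.F.whisker_right_comp1)
  also have "L \<lhd> (on1 Q a \<odot> n A) = M \<lhd> (on1 Q a \<odot> n A)"
  proof -
    have "\<psi> A \<odot> on1 P (a \<odot> \<phi> A) = on1 Q (a \<odot> \<phi> A) \<odot> \<psi> (on0 R A)"
      by (intro P.natural1'[symmetric]) simp_all
    then have square: "on1 Q a \<odot> n A = \<psi> A \<odot> on1 P (a \<odot> \<phi> A)"
      by (simp add: n_def R.G.on1_comp1)
    have "L \<lhd> \<psi> A = M \<lhd> \<psi> A"
      unfolding L_def M_def by (rule compat_P)
    then have "L \<lhd> \<psi> A \<lhd> on1 P (a \<odot> \<phi> A) = M \<lhd> \<psi> A \<lhd> on1 P (a \<odot> \<phi> A)"
      by simp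
    then show ?thesis by (simp add: square R.F.whisker_right_comp1)
  qed
  also have "M \<lhd> (on1 Q a \<odot> n A) = (\<alpha> \<lhd> (a \<odot> on1 Q a \<odot> n A)) \<cdot> (\<rho> \<lhd> on1 Q a \<lhd> n A)"
    by (simp add: M_def R.F.whisker_right_vcomp R.F.whisker_right_comp1)
  also have "a \<odot> on1 Q a \<odot> n A = a"
    by (rule action_n[OF f.A.strict_algebra_axioms])
  also have "((\<alpha> \<lhd> a) \<cdot> (\<rho> \<lhd> on1 Q a \<lhd> n A)) \<cdot> ((b \<rhd> on2 Q \<rho>) \<lhd> n A)
      = (\<alpha> \<lhd> a) \<cdot> ((\<rho> \<lhd> on1 Q a \<lhd> n A) \<cdot> ((b \<rhd> on2 Q \<rho>) \<lhd> n A))"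
    by (simp add: R.F.vcomp_assoc' R.G.on1_comp1 action_n[OF f.A.strict_algebra_axioms])
  also have "\<dots> = M"
    by (simp only: M_def cell_n[OF assms(3), symmetric])
  finally show ?thesis
    by (simp only: L_def M_def)
qed


section \<open>The two maps into the composite monad\<close>

context distributive_law
begin

abbreviation TS where "TS \<equiv> composite_monad C S T l"

lemma TS_simps [simp]:
  "on0 TS A = on0 T (on0 S A)" "on1 TS f = on1 T (on1 S f)" "on2 TS \<alpha> = on2 T (on2 S \<alpha>)"
  "unit TS A = unit T (on0 S A) \<odot> unit S A"
  "mult TS A = mult T (on0 S A) \<odot> on1 T (on1 T (mult S A)) \<odot> on1 T (l (on0 S A))"
  by (simp_all add: composite_monad_def)

lemmas endo_simps [simp] = id_endo_def comp_endo_def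

lemma TS_functor: "endo_2_functor C TS"
  using law.G.endo_2_functor_axioms
  by (simp add: endo_2_functor_def endo_2_functor_axioms_def)

lemma components_typing [simp]:
  assumes "A \<in> obj C"
  shows "unit S A \<in> arr C" "src C (unit S A) = A" "trg C (unit S A) = on0 S A"
    "unit T A \<in> arr C" "src C (unit T A) = A" "trg C (unit T A) = on0 T A"
    "mult S A \<in> arr C" "src C (mult S A) = on0 S (on0 S A)" "trg C (mult S A) = on0 S A"
    "mult T A \<in> arr C" "src C (mult T A) = on0 T (on0 T A)" "trg C (mult T A) = on0 T A"
    "l A \<in> arr C" "src C (l A) = on0 S (on0 T A)" "trg C (l A) = on0 T (on0 S A)"
  using assms S.unit.component_typing[of A] T.unit.component_typing[of A]
    S.mult.component_typing[of A] T.mult.component_typing[of A] law.component_typing[of A]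
  by simp_all

text \<open>
  In the multiplication of \<open>TS\<close>, \<open>\<lambda>\<close> acts on the two middle factors of \<open>TSTS\<close>. Inserting a unit in one of them cancels
  \<open>\<lambda>\<close> by its unit law and then one of the two multiplications by the unit law of that monad; the
  multiplication of the other monad is left. The next two lemmas are the two cases.
\<close>

lemma mult_TS_unit_T:
  assumes "A \<in> obj C"
  shows "mult TS A \<odot> on1 TS (unit T (on0 S A)) = on1 T (mult S A)"
proof -
  have "mult TS A \<odot> on1 TS (unit T (on0 S A))
      = mult T (on0 S A) \<odot> on1 T (on1 T (mult S A) \<odot> l (on0 S A) \<odot> on1 S (unit T (on0 S A)))"
    using assms by (simp add: T.endo.on1_comp1)
  also have "l (on0 S A) \<odot> on1 S (unit T (on0 S A)) = unit T (on0 S (on0 S A))"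
    using assms by (simp add: law_unit_T)
  also have "on1 T (mult S A) \<odot> unit T (on0 S (on0 S A)) = unit T (on0 S A) \<odot> mult S A"
    using T.unit.natural1'[of "mult S A" "on0 S (on0 S A)" "on0 S A"] assms by simp
  also have "mult T (on0 S A) \<odot> on1 T (unit T (on0 S A) \<odot> mult S A)
      = (mult T (on0 S A) \<odot> on1 T (unit T (on0 S A))) \<odot> on1 T (mult S A)"
    using assms by (simp add: T.endo.on1_comp1)
  also have "\<dots> = on1 T (mult S A)"
    using assms by (simp add: T.mult_unit_right)
  finally show ?thesis .
qed

lemma mult_TS_unit_S:
  assumes "A \<in> obj C"
  shows "mult TS A \<odot> on1 T (unit S (on0 T (on0 S A))) = mult T (on0 S A)"
proof -
  have "mult TS A \<odot> on1 T (unit S (on0 T (on0 S A)))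
      = mult T (on0 S A) \<odot> on1 T (on1 T (mult S A) \<odot> l (on0 S A) \<odot> unit S (on0 T (on0 S A)))"
    using assms by (simp add: T.endo.on1_comp1)
  also have "l (on0 S A) \<odot> unit S (on0 T (on0 S A)) = on1 T (unit S (on0 S A))"
    using assms by (simp add: law_unit_S)
  also have "on1 T (mult S A) \<odot> on1 T (unit S (on0 S A)) = id1 C (on0 T (on0 S A))"
    using assms by (simp add: T.endo.on1_comp1[symmetric] S.mult_unit_left T.endo.on1_id)
  finally show ?thesis
    using assms by (simp add: T.endo.on1_id)
qed

lemma S_to_TS: "monad_map C S TS (\<lambda>A. unit T (on0 S A))"
proof -
  interpret TS: endo_2_functor C TS by (rule TS_functor)
  show ?thesis
  proof
    fix A assume [simp]: "A \<in> obj C"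
    show "unit T (on0 S A) \<in> hom1 C (on0 S A) (on0 TS A)"
      by (simp add: S.endo.hom1_iff)
    show "unit S A \<in> hom1 C A (on0 S A)" "mult S A \<in> hom1 C (on0 S (on0 S A)) (on0 S A)"
      "mult TS A \<in> hom1 C (on0 TS (on0 TS A)) (on0 TS A)"
      by (simp_all add: S.endo.hom1_iff)
    show "unit T (on0 S A) \<odot> unit S A = unit TS A"
      by simp
    have "unit T (on0 S A) \<odot> mult S A = on1 T (mult S A) \<odot> unit T (on0 S (on0 S A))"
      using T.unit.natural1'[of "mult S A" "on0 S (on0 S A)" "on0 S A"] by simp
    also have "\<dots> = (mult TS A \<odot> on1 TS (unit T (on0 S A))) \<odot> unit T (on0 S (on0 S A))"
      by (simp only: mult_TS_unit_T \<open>A \<in> obj C\<close>)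
    finally show "unit T (on0 S A) \<odot> mult S A
        = mult TS A \<odot> on1 TS (unit T (on0 S A)) \<odot> unit T (on0 S (on0 S A))"
      by simp
  next
    fix f A B assume "f \<in> hom1 C A B"
    then show "on1 TS f \<odot> unit T (on0 S A) = unit T (on0 S B) \<odot> on1 S f"
      using T.unit.natural1'[of "on1 S f" "on0 S A" "on0 S B"] by (auto simp: S.endo.hom1_iff)
  next
    fix f A B \<alpha> g assume "f \<in> hom1 C A B" "\<alpha> \<in> hom2 C f g"
    then show "on2 TS \<alpha> \<lhd> unit T (on0 S A) = unit T (on0 S B) \<rhd> on2 S \<alpha>"
      using T.unit.natural2'[of "on2 S \<alpha>" "on0 S A" "on0 S B"]
      by (auto simp: S.endo.hom1_iff S.endo.hom2_iff)
  qed
qed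

lemma T_to_TS: "monad_map C T TS (\<lambda>A. on1 T (unit S A))"
proof -
  interpret TS: endo_2_functor C TS by (rule TS_functor)
  show ?thesis
  proof
    fix A assume [simp]: "A \<in> obj C"
    show "on1 T (unit S A) \<in> hom1 C (on0 T A) (on0 TS A)"
      by (simp add: S.endo.hom1_iff)
    show "unit T A \<in> hom1 C A (on0 T A)" "mult T A \<in> hom1 C (on0 T (on0 T A)) (on0 T A)"
      "mult TS A \<in> hom1 C (on0 TS (on0 TS A)) (on0 TS A)"
      by (simp_all add: S.endo.hom1_iff)
    show "on1 T (unit S A) \<odot> unit T A = unit TS A"
      using T.unit.natural1'[of "unit S A" A "on0 S A"] by simp
    \<comment> \<open>The inserted \<open>\<eta>\<^sup>S\<close> has to be moved next to the multiplication for \<open>\<lambda>\<close> to cancel.\<close>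
    have "unit S (on0 T (on0 S A)) \<odot> on1 T (unit S A) = on1 S (on1 T (unit S A)) \<odot> unit S (on0 T A)"
      using S.unit.natural1'[of "on1 T (unit S A)" "on0 T A" "on0 T (on0 S A)"] by simp
    then have nat: "on1 T (unit S (on0 T (on0 S A))) \<odot> on1 T (on1 T (unit S A))
        = on1 TS (on1 T (unit S A)) \<odot> on1 T (unit S (on0 T A))"
      by (simp add: T.endo.on1_comp1[symmetric])
    have "on1 T (unit S A) \<odot> mult T A = mult T (on0 S A) \<odot> on1 T (on1 T (unit S A))"
      using T.mult.natural1'[of "unit S A" A "on0 S A"] by simp
    also have "\<dots> = (mult TS A \<odot> on1 T (unit S (on0 T (on0 S A)))) \<odot> on1 T (on1 T (unit S A))"
      by (simp only: mult_TS_unit_S \<open>A \<in> obj C\<close>)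
    also have "\<dots> = mult TS A \<odot> (on1 T (unit S (on0 T (on0 S A))) \<odot> on1 T (on1 T (unit S A)))"
      by simp
    finally show "on1 T (unit S A) \<odot> mult T A
        = mult TS A \<odot> on1 TS (on1 T (unit S A)) \<odot> on1 T (unit S (on0 T A))"
      by (simp only: nat)
  next
    fix f A B assume "f \<in> hom1 C A B"
    then show "on1 TS f \<odot> on1 T (unit S A) = on1 T (unit S B) \<odot> on1 T f"
      using S.unit.natural1'[of f A B]
      by (auto simp: S.endo.hom1_iff T.endo.on1_comp1[symmetric])
  next
    fix f A B \<alpha> g assume "f \<in> hom1 C A B" "\<alpha> \<in> hom2 C f g"
    then show "on2 TS \<alpha> \<lhd> on1 T (unit S A) = on1 T (unit S B) \<rhd> on2 T \<alpha>"
      using S.unit.natural2'[of \<alpha> A B]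
      by (auto simp: S.endo.hom1_iff S.endo.hom2_iff T.endo.on2_whisker_right[symmetric]
          T.endo.on2_whisker_left[symmetric])
  qed
qed

text \<open>
  This section property implies that every \<open>TS\<close>-action is the associated \<open>T\<close>-action
  after \<open>T\<close> of the associated \<open>S\<close>-action.
\<close>

lemma TS_generated:
  assumes "A \<in> obj C"
  shows "mult TS A \<odot> on1 TS (unit T (on0 S A)) \<odot> on1 T (unit S (on0 S A)) = id1 C (on0 TS A)"
proof -
  have "mult TS A \<odot> on1 TS (unit T (on0 S A)) \<odot> on1 T (unit S (on0 S A))
      = (mult TS A \<odot> on1 TS (unit T (on0 S A))) \<odot> on1 T (unit S (on0 S A))"
    using assms by simp
  also have "\<dots> = on1 T (mult S A) \<odot> on1 T (unit S (on0 S A))"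
    by (simp only: mult_TS_unit_T assms)
  also have "\<dots> = id1 C (on0 TS A)"
    using assms by (simp add: T.endo.on1_comp1[symmetric] S.mult_unit_left T.endo.on1_id)
  finally show ?thesis .
qed

end


section \<open>Transformations of algebras over the composite monad\<close>

theorem theorem2p12:
  fixes C :: "('o, 'm, 'c) two_cat"
    and S T :: "('o, 'm, 'c) monad"
    and l :: "'o \<Rightarrow> 'm"
    and A B :: 'o and a b f g :: 'm and \<zeta>\<^sub>f \<zeta>\<^sub>g \<alpha> :: 'c
  assumes "distributive_law C S T l"
    and "weak_map C (composite_monad C S T l) A a B b f \<zeta>\<^sub>f"
    and "weak_map C (composite_monad C S T l) A a B b g \<zeta>\<^sub>g"
  shows "alg_transformation C (composite_monad C S T l) A a B b f \<zeta>\<^sub>f g \<zeta>\<^sub>g \<alpha> \<longleftrightarrow>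
    alg_transformation C S A (action_S C S T A a) B (action_S C S T B b)
      f (weak_cell_S C S T A \<zeta>\<^sub>f) g (weak_cell_S C S T A \<zeta>\<^sub>g) \<alpha> \<and>
    alg_transformation C T A (action_T C S T A a) B (action_T C S T B b)
      f (weak_cell_T C S T A \<zeta>\<^sub>f) g (weak_cell_T C S T A \<zeta>\<^sub>g) \<alpha>"
proof (cases "\<alpha> \<in> hom2 C f g")
  case True
  interpret distributive_law C S T l by fact
  note restricted =
    monad_map.restricted_compat_iff[OF S_to_TS assms(2,3) True]
    monad_map.restricted_compat_iff[OF T_to_TS assms(2,3) True]
  note generated = compat_from_generating_maps[OF S_to_TS T_to_TS assms(2,3) True]
  have "alg_transformation C TS A a B b f \<zeta>\<^sub>f g \<zeta>\<^sub>g \<alpha> \<longleftrightarrow>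
      \<zeta>\<^sub>g \<cdot>\<^bsub>C\<^esub> (b \<rhd>\<^bsub>C\<^esub> on2 TS \<alpha>) = (\<alpha> \<lhd>\<^bsub>C\<^esub> a) \<cdot>\<^bsub>C\<^esub> \<zeta>\<^sub>f"
    using assms(2,3) True
    by (auto simp: alg_transformation_def alg_transformation_axioms_def)
  then show ?thesis
    unfolding action_S_def action_T_def weak_cell_S_def weak_cell_T_def restricted
    using generated[OF _ _ _ _ TS_generated] by auto
next
  case False
  then show ?thesis
    by (simp add: alg_transformation_def alg_transformation_axioms_def)
qed

end
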